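(* Let $P$ be a finite poset of cardinality $n$, maximum outdegree $\upsilon$, and maximum indegree $\delta$. Then both of the following bounds hold: $$\dim_2(P) \le \big\lceil 2e(\upsilon+2)\log n \big\rceil,$$ $$\dim_2(P) \le \Big\lceil e(\upsilon+2)\big(\log n + \log(\upsilon+2) + \log(\delta+2) + 1\big)\Big\rceil.$$
   Context: For a poset $P$ and $x\in P$, the outdegree of $x$ is $|\{y\in P : y > x\}|$ and the indegree of $x$ is $|\{y\in P: y<x\}|$; the maximum outdegree (indegree) is the maximum of these over $x\in P$. A poset embedding $P \hookrightarrow Q$ is a map $\varphi$ with $\varphi(a)\le_Q\varphi(b)$ if and only if $a\le_P b$. The $2$-dimension $\dim_2(P)$ of a finite poset $P$ is the minimum $d$ such that $P$ embeds into the poset of all subsets of $\{1,\dots,d\}$ ordered by inclusion. $\log$ is the natural logarithm and $e$ is its base. *)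

theory Defs
  imports Complex_Main
begin

text \<open>
  A poset is a carrier \<open>A\<close> together with a relation \<open>r\<close> such that \<open>partial_order_on A r\<close>,
  where \<open>(x, y) \<in> r\<close> means \<open>x \<le> y\<close>. Then \<open>r \<subseteq> A \<times> A\<close>, so the strict up-set \<open>aboveS r x\<close>
  and the strict down-set \<open>underS r x\<close> of any \<open>x\<close> lie inside \<open>A\<close>.
\<close>

definition outdegree :: "'a rel \<Rightarrow> 'a \<Rightarrow> nat" where
  "outdegree r x = card (aboveS r x)"

definition indegree :: "'a rel \<Rightarrow> 'a \<Rightarrow> nat" where
  "indegree r x = card (underS r x)"

text \<open>As \<open>Max {}\<close> is unspecified, so are these two for an empty carrier.\<close>

definition max_outdegree :: "'a set \<Rightarrow> 'a rel \<Rightarrow> nat" where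
  "max_outdegree A r = Max (outdegree r ` A)"

definition max_indegree :: "'a set \<Rightarrow> 'a rel \<Rightarrow> nat" where
  "max_indegree A r = Max (indegree r ` A)"

definition poset_embedding ::
  "'a set \<Rightarrow> 'a rel \<Rightarrow> 'b set \<Rightarrow> 'b rel \<Rightarrow> ('a \<Rightarrow> 'b) \<Rightarrow> bool" where
  "poset_embedding A r B s \<phi> \<longleftrightarrow>
     \<phi> ` A \<subseteq> B \<and> (\<forall>a\<in>A. \<forall>b\<in>A. (\<phi> a, \<phi> b) \<in> s \<longleftrightarrow> (a, b) \<in> r)"

definition embeds_in_cube :: "'a set \<Rightarrow> 'a rel \<Rightarrow> nat \<Rightarrow> bool" where
  "embeds_in_cube A r d \<longleftrightarrow>
     (\<exists>\<phi>. poset_embedding A r (Pow {1..d}) (relation_of (\<subseteq>) (Pow {1..d})) \<phi>)"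

definition dim2 :: "'a set \<Rightarrow> 'a rel \<Rightarrow> nat" where
  "dim2 A r = (LEAST d. embeds_in_cube A r d)"

text \<open>For a finite poset the minimum in \<open>dim2\<close> is attained: send each element to the
  set of indices of the elements below it.\<close>

lemma embeds_in_cube_card:
  assumes "finite A" and "partial_order_on A r"
  shows "embeds_in_cube A r (card A)"
proof -
  obtain f where f: "bij_betw f A {1..card A}"
    using finite_same_card_bij[OF assms(1), of "{1..card A}"] by auto
  have sub: "under r x \<subseteq> A" for x
    using assms(2) by (auto simp: order_on_defs under_def)
  have iff: "f ` under r a \<subseteq> f ` under r b \<longleftrightarrow> (a, b) \<in> r" if "a \<in> A" "b \<in> A" for a b
  proof -
    have mem: "f x \<in> f ` under r b \<longleftrightarrow> x \<in> under r b" if "x \<in> A" for x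
      using f that sub by (intro inj_on_image_mem_iff) (auto simp: bij_betw_def)
    have "f ` under r a \<subseteq> f ` under r b \<longleftrightarrow> under r a \<subseteq> under r b"
      unfolding image_subset_iff using mem sub[of a] by blast
    also have "\<dots> \<longleftrightarrow> (a, b) \<in> r"
      using assms(2) that by (auto simp: order_on_defs under_def refl_on_def dest: transD)
    finally show ?thesis .
  qed
  have "f ` under r x \<subseteq> {1..card A}" for x
    using f sub[of x] by (auto simp: bij_betw_def)
  then have "poset_embedding A r (Pow {1..card A}) (relation_of (\<subseteq>) (Pow {1..card A}))
      (\<lambda>x. f ` under r x)"
    using iff by (auto simp: poset_embedding_def relation_of_def)
  then show ?thesis
    unfolding embeds_in_cube_def by blast
qed

lemma embeds_in_cube_dim2:
  assumes "finite A" and "partial_order_on A r"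
  shows "embeds_in_cube A r (dim2 A r)"
  unfolding dim2_def using embeds_in_cube_card[OF assms] by (rule LeastI)

end

theory Submission
  imports Defs "HOL-Probability.Product_PMF"
begin

text \<open>
  An element of the cube is a subset of \<open>{1..d}\<close>, so a monotone map from \<open>P\<close> to the cube is a list
  of \<open>d\<close> up-sets \<open>U\<^sub>1, \<dots>, U\<^sub>d\<close>, and it is an embedding iff for all \<open>a\<close>, \<open>b\<close> with \<open>\<not> a \<le> b\<close> some
  \<open>U\<^sub>i\<close> contains \<open>a\<close> and not \<open>b\<close>. Random up-sets do this. Mark each element
  of \<open>P\<close> independently with probability \<open>1 / (\<upsilon> + 2)\<close>, and let \<open>U\<close> be the set of those elements that
  have no marked element at or above them. Then \<open>U\<close> separates \<open>a\<close> from \<open>b\<close> as soon as \<open>b\<close> is marked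
  and none of the at most \<open>\<upsilon> + 1\<close> elements at or above \<open>a\<close> is. As \<open>b\<close> is not among the latter, this has
  probability at least \<open>(1 / (\<upsilon> + 2)) * (1 - 1 / (\<upsilon> + 2)) ^ (\<upsilon> + 1) \<ge> 1 / (e * (\<upsilon> + 2))\<close>. With \<open>d\<close>
  independent up-sets a given pair therefore remains unseparated with probability at most
  \<open>exp (- d / (e * (\<upsilon> + 2)))\<close> (\<open>prob_unseparated_le\<close>).

  If \<open>d\<close> is at least \<open>2 * e * (\<upsilon> + 2) * ln n\<close>, this failure probability is at most \<open>1 / n\<^sup>2\<close>, and
  there are fewer than \<open>n\<^sup>2\<close> pairs to separate, so a union bound gives the first estimate.

  For the second one, the failure of \<open>(a, b)\<close> depends only on the marks of \<open>b\<close> and of the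
  elements at or above \<open>a\<close>. This set of at most \<open>\<upsilon> + 2\<close> elements meets the corresponding set of at
  most \<open>N = n * (\<upsilon> + 2) * (\<delta> + 2)\<close> pairs (\<open>card_conflicting_pairs_le\<close>). By the symmetric Lovasz
  local lemma all failures can be avoided at once if each has probability at most \<open>1 / (e * N)\<close>, and
  this is what \<open>d \<ge> e * (\<upsilon> + 2) * (ln N + 1)\<close> ensures.
\<close>

section \<open>The symmetric Lovasz local lemma\<close>

lemma exp_minus_one_le_power:
  "exp (- 1) \<le> (1 - 1 / (real m + 1)) ^ m"
proof (cases "m = 0")
  case False
  have "(1 + 1 / real m) ^ m \<le> exp (1 / real m) ^ m"
    by (intro power_mono) auto
  also have "\<dots> = exp 1"
    using False by (simp flip: exp_of_nat_mult)
  finally have "inverse (exp 1) \<le> inverse ((1 + 1 / real m) ^ m)"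
    by (intro le_imp_inverse_le zero_less_power) (auto intro: add_pos_nonneg)
  also have "\<dots> = (1 - 1 / (real m + 1)) ^ m"
    using False by (simp add: power_inverse[symmetric] field_simps)
  finally show ?thesis
    by (simp add: exp_minus)
qed simp

text \<open>
  The key is that every event \<open>A i\<close> has conditional probability at most \<open>1 / (m + 1)\<close> given that any
  set \<open>J\<close> of events is avoided, by strong induction on \<open>card J\<close>. Split \<open>J\<close> into the neighbours
  \<open>J1\<close> of \<open>i\<close> and the rest \<open>J2\<close>. Given that \<open>J2\<close> is avoided, \<open>A i\<close> has probability at most \<open>p\<close>;
  avoiding the at most \<open>m\<close> events of \<open>J1\<close> as well costs, by the induction hypothesis, at most a
  factor \<open>(1 - 1 / (m + 1)) ^ m \<ge> 1 / e\<close>. So the conditional probability of \<open>A i\<close> is at most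
  \<open>e * p \<le> 1 / (m + 1)\<close>.

  Conditional probabilities are written multiplied out, so that the statements make sense also for
  conditioning events of probability \<open>0\<close>.
\<close>

lemma lovasz_local_lemma:
  fixes M :: "'b pmf" and A :: "'i \<Rightarrow> 'b set" and \<Gamma> :: "'i \<Rightarrow> 'i set" and m :: nat and p :: real
  assumes "finite I" and "1 \<le> m" and "0 \<le> p"
    and \<Gamma>: "\<And>i. i \<in> I \<Longrightarrow> finite (\<Gamma> i) \<and> i \<in> \<Gamma> i \<and> card (\<Gamma> i) \<le> Suc m"
    and indep: "\<And>i J. i \<in> I \<Longrightarrow> J \<subseteq> I - \<Gamma> i \<Longrightarrow>
        measure_pmf.prob M (A i \<inter> (\<Inter>j\<in>J. - A j)) \<le> p * measure_pmf.prob M (\<Inter>j\<in>J. - A j)"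
    and p: "exp 1 * p * (real m + 1) \<le> 1"
  shows "0 < measure_pmf.prob M (\<Inter>i\<in>I. - A i)"
proof -
  define good where "good J = (\<Inter>j\<in>J. - A j)" for J
  define \<mu> where "\<mu> = measure_pmf.prob M"
  define x where "x = 1 / (real m + 1)"
  have x: "0 < x" "x < 1"
    using \<open>1 \<le> m\<close> by (auto simp: x_def)
  have mono: "\<mu> X \<le> \<mu> Y" if "X \<subseteq> Y" for X Y
    using that by (auto simp: \<mu>_def intro: measure_pmf.finite_measure_mono)
  \<comment> \<open>The chain rule: further events are avoided one at a time.\<close>
  have extend: "(1 - x) ^ card K * \<mu> (good J) \<le> \<mu> (good (J \<union> K))"
    if "finite K" and step: "\<And>k L. k \<in> K \<Longrightarrow> L \<subseteq> K - {k} \<Longrightarrow>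
        \<mu> (A k \<inter> good (J \<union> L)) \<le> x * \<mu> (good (J \<union> L))" for J K
    using that
  proof (induction K rule: finite_induct)
    case (insert k K)
    have "(1 - x) ^ card (insert k K) * \<mu> (good J) = (1 - x) * ((1 - x) ^ card K * \<mu> (good J))"
      using insert by simp
    also have "\<dots> \<le> (1 - x) * \<mu> (good (J \<union> K))"
      using x insert by (intro mult_left_mono insert.IH) (auto simp: insert_Diff_if subset_iff)
    also have "\<dots> \<le> \<mu> (good (J \<union> K)) - \<mu> (A k \<inter> good (J \<union> K))"
      using insert.prems[of k K] insert.hyps by (auto simp: algebra_simps)
    also have "\<dots> = \<mu> (good (J \<union> K) - A k \<inter> good (J \<union> K))"
      unfolding \<mu>_def by (intro measure_pmf.finite_measure_Diff[symmetric]) auto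
    also have "good (J \<union> K) - A k \<inter> good (J \<union> K) = good (J \<union> insert k K)"
      by (auto simp: good_def)
    finally show ?case .
  qed simp
  have conditional: "\<mu> (A i \<inter> good J) \<le> x * \<mu> (good J)" if "J \<subseteq> I" "i \<in> I" for i J
    using that
  proof (induction "card J" arbitrary: i J rule: less_induct)
    case less
    have fin: "finite J"
      using less.prems \<open>finite I\<close> by (auto intro: finite_subset)
    show ?case
    proof (cases "i \<in> J")
      case True
      then have "A i \<inter> good J = {}"
        by (auto simp: good_def)
      then show ?thesis
        using x by (simp add: \<mu>_def)
    next
      case False
      define J1 where "J1 = J \<inter> \<Gamma> i"
      define J2 where "J2 = J - \<Gamma> i"
      have J: "J = J2 \<union> J1"
        by (auto simp: J1_def J2_def)
      have "card J1 \<le> card (\<Gamma> i - {i})"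
        using \<Gamma>[OF less.prems(2)] False by (intro card_mono) (auto simp: J1_def)
      also have "\<dots> \<le> m"
        using \<Gamma>[OF less.prems(2)] by auto
      finally have "(1 - x) ^ m \<le> (1 - x) ^ card J1"
        using x by (intro power_decreasing) auto
      then have "exp (- 1) \<le> (1 - x) ^ card J1"
        using exp_minus_one_le_power[of m] by (simp add: x_def)
      then have "exp (- 1) * \<mu> (good J2) \<le> (1 - x) ^ card J1 * \<mu> (good J2)"
        by (intro mult_right_mono) (auto simp: \<mu>_def)
      also have "\<dots> \<le> \<mu> (good J)"
        unfolding J
      proof (rule extend)
        fix k L assume kL: "k \<in> J1" "L \<subseteq> J1 - {k}"
        show "\<mu> (A k \<inter> good (J2 \<union> L)) \<le> x * \<mu> (good (J2 \<union> L))"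
        proof (rule less.hyps)
          have "J2 \<union> L \<subset> J"
            using kL by (auto simp: J1_def J2_def)
          then show "card (J2 \<union> L) < card J"
            using fin by (rule psubset_card_mono[rotated])
          show "J2 \<union> L \<subseteq> I" "k \<in> I"
            using kL less.prems by (auto simp: J1_def J2_def)
        qed
      qed (use fin in \<open>auto simp: J1_def\<close>)
      finally have J2: "\<mu> (good J2) \<le> exp 1 * \<mu> (good J)"
        by (simp add: exp_minus field_simps)
      have "\<mu> (A i \<inter> good J) \<le> \<mu> (A i \<inter> good J2)"
        by (intro mono) (auto simp: good_def J2_def)
      also have "\<dots> \<le> p * \<mu> (good J2)"
        unfolding \<mu>_def good_def using less.prems by (intro indep) (auto simp: J2_def)
      also have "\<dots> \<le> p * (exp 1 * \<mu> (good J))"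
        using J2 \<open>0 \<le> p\<close> by (rule mult_left_mono)
      also have "\<dots> = (exp 1 * p) * \<mu> (good J)"
        by simp
      also have "\<dots> \<le> x * \<mu> (good J)"
        using p by (intro mult_right_mono) (auto simp: \<mu>_def x_def field_simps)
      finally show ?thesis .
    qed
  qed
  have "0 < (1 - x) ^ card I * \<mu> (good {})"
    using x by (simp add: \<mu>_def good_def)
  also have "\<dots> \<le> \<mu> (good ({} \<union> I))"
    using \<open>finite I\<close> by (intro extend conditional) auto
  finally show ?thesis
    by (simp add: \<mu>_def good_def)
qed

section \<open>Independence in product distributions\<close>

definition depends_on :: "'v set \<Rightarrow> ('v \<Rightarrow> 'b) set \<Rightarrow> bool" where
  "depends_on S X \<longleftrightarrow> (\<forall>f g. (\<forall>v\<in>S. f v = g v) \<longrightarrow> f \<in> X \<longrightarrow> g \<in> X)"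

lemma depends_onD: "depends_on S X \<Longrightarrow> (\<And>v. v \<in> S \<Longrightarrow> f v = g v) \<Longrightarrow> f \<in> X \<longleftrightarrow> g \<in> X"
  unfolding depends_on_def by metis

lemma prob_pair_pmf_times:
  "measure_pmf.prob (pair_pmf M N) (X \<times> Y) = measure_pmf.prob M X * measure_pmf.prob N Y"
proof -
  have "measure_pmf.prob (pair_pmf M N) (X \<times> Y)
      = measure_pmf.prob (pair_pmf M N) ((X \<times> Y) \<inter> set_pmf (pair_pmf M N))"
    by (simp only: measure_Int_set_pmf)
  also have "(X \<times> Y) \<inter> set_pmf (pair_pmf M N) = (X \<inter> set_pmf M) \<times> (Y \<inter> set_pmf N)"
    by auto
  also have "measure_pmf.prob (pair_pmf M N) \<dots>
      = measure_pmf.prob M (X \<inter> set_pmf M) * measure_pmf.prob N (Y \<inter> set_pmf N)"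
    by (intro measure_pmf_prob_product) (auto intro: countable_subset[OF Int_lower2])
  finally show ?thesis
    by (simp add: measure_Int_set_pmf)
qed

text \<open>
  A sample on \<open>V\<close> is glued from independent samples on \<open>S\<close> and on \<open>V - S\<close>; one event is decided by
  the first part and the other by the second.
\<close>

lemma prob_Pi_pmf_Int_disjoint:
  assumes "finite V" and "S \<subseteq> V" "T \<subseteq> V" "S \<inter> T = {}"
    and X: "depends_on S X" and Y: "depends_on T Y"
  shows "measure_pmf.prob (Pi_pmf V d p) (X \<inter> Y)
       = measure_pmf.prob (Pi_pmf V d p) X * measure_pmf.prob (Pi_pmf V d p) Y"
proof -
  let ?h = "\<lambda>(f, g) v. if v \<in> S then f v else g v"
  define \<mu> where "\<mu> W = measure_pmf.prob (Pi_pmf W d p)" for W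
  have split: "\<mu> V (X' \<inter> Y') = \<mu> S X' * \<mu> (V - S) Y'"
    if "depends_on S X'" "depends_on T Y'" for X' Y'
  proof -
    have "Pi_pmf (S \<union> (V - S)) d p
        = map_pmf ?h (pair_pmf (Pi_pmf S d p) (Pi_pmf (V - S) d p))"
      using assms by (intro Pi_pmf_union) (auto intro: finite_subset)
    moreover have "S \<union> (V - S) = V"
      using assms by auto
    moreover have "?h (f, g) \<in> X' \<longleftrightarrow> f \<in> X'" for f g
      by (rule depends_onD[OF that(1)]) simp
    moreover have "?h (f, g) \<in> Y' \<longleftrightarrow> g \<in> Y'" for f g
      using assms(4) by (intro depends_onD[OF that(2)]) auto
    ultimately have "\<mu> V (X' \<inter> Y')
        = measure_pmf.prob (pair_pmf (Pi_pmf S d p) (Pi_pmf (V - S) d p)) (X' \<times> Y')"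
      unfolding \<mu>_def by (auto simp: vimage_def intro!: arg_cong[where f = "measure _"])
    then show ?thesis
      by (simp add: prob_pair_pmf_times \<mu>_def)
  qed
  \<comment> \<open>Splitting off the sure event identifies the two factors as probabilities on \<open>V\<close>.\<close>
  have UNIV: "depends_on W UNIV" for W :: "'a set"
    by (simp add: depends_on_def)
  have "\<mu> V X = \<mu> S X" "\<mu> V Y = \<mu> (V - S) Y"
    using split[OF X UNIV] split[OF UNIV Y] by (auto simp: \<mu>_def)
  then show ?thesis
    using split[OF X Y] by (simp add: \<mu>_def)
qed

lemma depends_on_Inter_Compl:
  assumes "\<And>j. j \<in> J \<Longrightarrow> depends_on (S j) (X j)"
  shows "depends_on (\<Union>j\<in>J. S j) (\<Inter>j\<in>J. - X j)"
  unfolding depends_on_def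
proof (intro allI impI)
  fix f g assume agree: "\<forall>v\<in>\<Union>j\<in>J. S j. f v = g v" and f: "f \<in> (\<Inter>j\<in>J. - X j)"
  have "f \<in> X j \<longleftrightarrow> g \<in> X j" if "j \<in> J" for j
    using that agree by (intro depends_onD[OF assms]) auto
  then show "g \<in> (\<Inter>j\<in>J. - X j)"
    using f by auto
qed

lemma prob_Pi_bernoulli_pattern:
  assumes "finite V" "S \<subseteq> V" "T \<subseteq> V" "S \<inter> T = {}" and p: "0 \<le> p" "p \<le> 1"
  shows "measure_pmf.prob (Pi_pmf V d (\<lambda>_. bernoulli_pmf p))
      {f. (\<forall>v\<in>S. f v) \<and> (\<forall>v\<in>T. \<not> f v)} = p ^ card S * (1 - p) ^ card T"
proof -
  define B where "B v = (if v \<in> S then {True} else if v \<in> T then {False} else UNIV)" for v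
  define q where "q v = (if v \<in> S then p else if v \<in> T then 1 - p else 1)" for v
  have fin: "finite S" "finite T"
    using assms by (auto intro: finite_subset)
  have "{f. (\<forall>v\<in>S. f v) \<and> (\<forall>v\<in>T. \<not> f v)} = Pi V B"
    using assms(2-4) by (auto simp: B_def Pi_def split: if_splits)
  then have "measure_pmf.prob (Pi_pmf V d (\<lambda>_. bernoulli_pmf p))
      {f. (\<forall>v\<in>S. f v) \<and> (\<forall>v\<in>T. \<not> f v)} = (\<Prod>v\<in>V. measure_pmf.prob (bernoulli_pmf p) (B v))"
    using assms by (simp add: measure_Pi_pmf_Pi)
  also have "\<dots> = (\<Prod>v\<in>V. q v)"
    using p by (intro prod.cong) (auto simp: B_def q_def measure_pmf_single)
  also have "\<dots> = (\<Prod>v\<in>S \<union> T. q v)"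
    using assms by (intro prod.mono_neutral_right) (auto simp: q_def)
  also have "\<dots> = (\<Prod>v\<in>S. q v) * (\<Prod>v\<in>T. q v)"
    using assms fin by (intro prod.union_disjoint) auto
  also have "(\<Prod>v\<in>S. q v) = p ^ card S"
    by (simp add: q_def)
  also have "(\<Prod>v\<in>T. q v) = (\<Prod>v\<in>T. 1 - p)"
    using assms(4) by (intro prod.cong) (auto simp: q_def)
  finally show ?thesis
    by simp
qed

section \<open>Random cuts of a poset\<close>

lemma partial_order_onD:
  assumes "partial_order_on P r"
  shows "r \<subseteq> P \<times> P" and "trans r" and "a \<in> P \<Longrightarrow> (a, a) \<in> r"
  using assms by (simp_all add: order_on_defs refl_on_def)

lemma above_subset: "partial_order_on P r \<Longrightarrow> above r a \<subseteq> P"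
  and under_subset: "partial_order_on P r \<Longrightarrow> under r a \<subseteq> P"
  using partial_order_onD(1)[of P r] by (auto simp: above_def under_def)

text \<open>
  A function \<open>f\<close> on \<open>P \<times> {1..d}\<close> records the marks: \<open>f (y, i)\<close> says that \<open>y\<close> is marked in round \<open>i\<close>,
  and round \<open>i\<close> yields the up-set of all \<open>x\<close> with no marked element in \<open>above r x\<close>. Asking for \<open>b\<close>
  itself to be marked, rather than any element of \<open>above r b\<close>, keeps the condition dependent on few
  marks.
\<close>

definition separates :: "'a rel \<Rightarrow> ('a \<times> nat \<Rightarrow> bool) \<Rightarrow> nat \<Rightarrow> 'a \<Rightarrow> 'a \<Rightarrow> bool" where
  "separates r f i a b \<longleftrightarrow> f (b, i) \<and> (\<forall>y\<in>above r a. \<not> f (y, i))"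

text \<open>The pair is a single argument because it indexes the events of the local lemma.\<close>

definition unseparated :: "'a rel \<Rightarrow> nat set \<Rightarrow> 'a \<times> 'a \<Rightarrow> ('a \<times> nat \<Rightarrow> bool) set" where
  "unseparated r D = (\<lambda>(a, b). {f. \<forall>i\<in>D. \<not> separates r f i a b})"

text \<open>The elements whose marks decide the separation of a pair.\<close>

definition support :: "'a rel \<Rightarrow> 'a \<times> 'a \<Rightarrow> 'a set" where
  "support r = (\<lambda>(a, b). insert b (above r a))"

text \<open>
  The embedding sends \<open>x\<close> to the rounds in which nothing at or above \<open>x\<close> is marked. It is monotone by
  transitivity, and a round that separates \<open>a\<close> from \<open>b\<close> is in the image of \<open>a\<close> but not of \<open>b\<close>, as \<open>b\<close>
  itself is marked.
\<close>

lemma dim2_le_if_separated: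
  assumes "partial_order_on P r"
    and sep: "\<And>a b. a \<in> P \<Longrightarrow> b \<in> P \<Longrightarrow> (a, b) \<notin> r \<Longrightarrow> \<exists>i\<in>{1..d}. separates r f i a b"
  shows "dim2 P r \<le> d"
proof -
  note refl = partial_order_onD(3)[OF assms(1)] and trans = partial_order_onD(2)[OF assms(1)]
  define \<phi> where "\<phi> a = {i\<in>{1..d}. \<forall>y\<in>above r a. \<not> f (y, i)}" for a
  have "\<phi> a \<subseteq> \<phi> b \<longleftrightarrow> (a, b) \<in> r" if ab: "a \<in> P" "b \<in> P" for a b
  proof
    assume "(a, b) \<in> r"
    then show "\<phi> a \<subseteq> \<phi> b"
      using trans by (auto simp: \<phi>_def above_def dest: transD)
  next
    assume sub: "\<phi> a \<subseteq> \<phi> b"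
    show "(a, b) \<in> r"
    proof (rule ccontr)
      assume "(a, b) \<notin> r"
      then obtain i where i: "i \<in> {1..d}" "separates r f i a b"
        using sep ab by blast
      then have "i \<in> \<phi> a" "i \<notin> \<phi> b"
        using refl[OF \<open>b \<in> P\<close>] by (auto simp: \<phi>_def separates_def above_def)
      then show False
        using sub by blast
    qed
  qed
  then have "poset_embedding P r (Pow {1..d}) (relation_of (\<subseteq>) (Pow {1..d})) \<phi>"
    by (auto simp: poset_embedding_def relation_of_def \<phi>_def)
  then show ?thesis
    unfolding dim2_def embeds_in_cube_def by (intro Least_le) blast
qed

lemma depends_on_unseparated:
  "depends_on (support r c \<times> D) (unseparated r D c)"
  by (cases c) (auto simp: depends_on_def unseparated_def separates_def support_def)

text \<open>
  Different rounds use disjoint sets of marks, so the failure probabilities multiply. The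
  exponent of \<open>1 - p\<close> is right because \<open>(a, b) \<notin> r\<close> keeps \<open>b\<close> out of \<open>above r a\<close>. The marks live on
  a fixed set \<open>E\<close> of rounds to allow induction on \<open>D\<close> without changing the distribution.
\<close>

lemma prob_unseparated:
  assumes "finite P" "finite E" "D \<subseteq> E" and p: "0 \<le> p" "p \<le> 1"
    and c: "support r (a, b) \<subseteq> P" "(a, b) \<notin> r"
  shows "measure_pmf.prob (Pi_pmf (P \<times> E) False (\<lambda>_. bernoulli_pmf p)) (unseparated r D (a, b))
    = (1 - p * (1 - p) ^ card (above r a)) ^ card D"
proof -
  let ?M = "Pi_pmf (P \<times> E) False (\<lambda>_. bernoulli_pmf p)"
  have "finite D"
    using assms by (auto intro: finite_subset)
  then show ?thesis
    using \<open>D \<subseteq> E\<close>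
  proof (induction D rule: finite_induct)
    case empty
    then show ?case
      by (simp add: unseparated_def)
  next
    case (insert i D)
    have "{f. separates r f i a b}
        = {f. (\<forall>v\<in>{(b, i)}. f v) \<and> (\<forall>v\<in>above r a \<times> {i}. \<not> f v)}"
      by (auto simp: separates_def)
    also have "measure_pmf.prob ?M \<dots> = p ^ card {(b, i)} * (1 - p) ^ card (above r a \<times> {i})"
      using assms insert.prems
      by (intro prob_Pi_bernoulli_pattern) (auto simp: support_def above_def)
    finally have sep: "measure_pmf.prob ?M {f. separates r f i a b}
        = p * (1 - p) ^ card (above r a)"
      by (simp add: card_cartesian_product)
    have "unseparated r {i} (a, b) = UNIV - {f. separates r f i a b}"
      by (auto simp: unseparated_def)
    then have one: "measure_pmf.prob ?M (unseparated r {i} (a, b))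
        = 1 - p * (1 - p) ^ card (above r a)"
      using sep measure_pmf.prob_compl[of "{f. separates r f i a b}" ?M] by simp
    have "unseparated r (insert i D) (a, b) = unseparated r {i} (a, b) \<inter> unseparated r D (a, b)"
      by (auto simp: unseparated_def)
    also have "measure_pmf.prob ?M \<dots> = measure_pmf.prob ?M (unseparated r {i} (a, b))
        * measure_pmf.prob ?M (unseparated r D (a, b))"
      using assms insert
      by (intro prob_Pi_pmf_Int_disjoint[OF _ _ _ _ depends_on_unseparated depends_on_unseparated])
        auto
    finally show ?case
      using insert by (simp add: one)
  qed
qed

text \<open>
  The marking probability \<open>1 / (u + 2)\<close> maximises \<open>p * (1 - p) ^ (u + 1)\<close>, the least
  possible probability that one round separates the pair.
\<close>

lemma prob_unseparated_le:
  assumes "finite P" "support r (a, b) \<subseteq> P" "(a, b) \<notin> r"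
    and above: "card (above r a) \<le> Suc u"
  shows "measure_pmf.prob (Pi_pmf (P \<times> {1..d}) False (\<lambda>_. bernoulli_pmf (1 / (real u + 2))))
      (unseparated r {1..d} (a, b)) \<le> exp (- (real d / (exp 1 * (real u + 2))))"
proof -
  define p where "p = 1 / (real u + 2)"
  have p: "0 \<le> p" "p \<le> 1"
    by (auto simp: p_def)
  have "exp (- 1) \<le> (1 - p) ^ Suc u"
    using exp_minus_one_le_power[of "Suc u"] by (simp add: p_def algebra_simps)
  also have "\<dots> \<le> (1 - p) ^ card (above r a)"
    using p above by (intro power_decreasing) auto
  finally have "p * exp (- 1) \<le> p * (1 - p) ^ card (above r a)"
    using p by (intro mult_left_mono)
  moreover have "p * (1 - p) ^ card (above r a) \<le> 1"
    using p by (intro mult_le_one power_le_one) auto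
  ultimately have "(1 - p * (1 - p) ^ card (above r a)) ^ d \<le> (1 - p * exp (- 1)) ^ d"
    by (intro power_mono) auto
  also have "\<dots> \<le> exp (- (p * exp (- 1))) ^ d"
  proof (rule power_mono)
    show "1 - p * exp (- 1) \<le> exp (- (p * exp (- 1)))"
      using exp_ge_add_one_self[of "- (p * exp (- 1))"] by simp
    show "0 \<le> 1 - p * exp (- 1)"
      using mult_le_one[of p "exp (- 1)"] p by simp
  qed
  also have "\<dots> = exp (- (real d / (exp 1 * (real u + 2))))"
    by (simp add: p_def exp_minus field_simps flip: exp_of_nat_mult)
  finally show ?thesis
    using prob_unseparated[OF assms(1) _ order_refl p assms(2,3), of "{1..d}"]
    by (simp add: p_def)
qed

section \<open>The two bounds\<close>

lemma above_eq_insert_aboveS: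
  assumes "partial_order_on P r" "a \<in> P"
  shows "above r a = insert a (aboveS r a)"
  using partial_order_onD(3)[OF assms] by (auto simp: above_def aboveS_def)

lemma under_eq_insert_underS:
  assumes "partial_order_on P r" "a \<in> P"
  shows "under r a = insert a (underS r a)"
  using partial_order_onD(3)[OF assms] by (auto simp: under_def underS_def)

lemma card_above_le:
  assumes "finite P" "partial_order_on P r" "a \<in> P"
  shows "card (above r a) \<le> Suc (max_outdegree P r)"
proof -
  have "finite (above r a)"
    using above_subset[OF assms(2)] assms(1) by (rule finite_subset)
  then have "card (above r a) \<le> Suc (outdegree r a)"
    using assms by (simp add: above_eq_insert_aboveS outdegree_def card_insert_if)
  also have "outdegree r a \<le> max_outdegree P r"
    using assms by (simp add: max_outdegree_def)
  finally show ?thesis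
    by simp
qed

lemma card_under_le:
  assumes "finite P" "partial_order_on P r" "a \<in> P"
  shows "card (under r a) \<le> Suc (max_indegree P r)"
proof -
  have "finite (under r a)"
    using under_subset[OF assms(2)] assms(1) by (rule finite_subset)
  then have "card (under r a) \<le> Suc (indegree r a)"
    using assms by (simp add: under_eq_insert_underS indegree_def card_insert_if)
  also have "indegree r a \<le> max_indegree P r"
    using assms by (simp add: max_indegree_def)
  finally show ?thesis
    by simp
qed

text \<open>
  A conflict is witnessed by an element \<open>z\<close> of both supports, one of at most \<open>\<upsilon> + 2\<close> elements of
  \<open>support r (a, b)\<close>. Given \<open>z\<close>, a conflicting pair has either \<open>z\<close> as its second entry (\<open>n\<close> pairs) or
  one of the at most \<open>\<delta> + 1\<close> elements at or below \<open>z\<close> as its first (at most \<open>(\<delta> + 1) * n\<close> pairs).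
\<close>

lemma card_conflicting_pairs_le:
  assumes "finite P" "partial_order_on P r" "a \<in> P"
  shows "card {c \<in> P \<times> P. support r (a, b) \<inter> support r c \<noteq> {}}
    \<le> card P * (max_outdegree P r + 2) * (max_indegree P r + 2)"
proof -
  let ?S = "support r (a, b) \<inter> P"
  note sub = above_subset[OF assms(2)] under_subset[OF assms(2)]
  have fin: "finite (above r x)" "finite (under r x)" for x
    using assms(1) sub by (meson finite_subset)+
  have "z \<in> P \<and> c \<in> P \<times> {z} \<union> under r z \<times> P" if "c \<in> P \<times> P" "z \<in> support r c" for c z
    using that sub by (cases c) (auto simp: support_def above_def under_def)
  then have "{c \<in> P \<times> P. support r (a, b) \<inter> support r c \<noteq> {}}
      \<subseteq> (\<Union>z\<in>?S. P \<times> {z} \<union> under r z \<times> P)"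
    by blast
  then have "card {c \<in> P \<times> P. support r (a, b) \<inter> support r c \<noteq> {}}
      \<le> card (\<Union>z\<in>?S. P \<times> {z} \<union> under r z \<times> P)"
    using assms fin by (intro card_mono) auto
  also have "\<dots> \<le> (\<Sum>z\<in>?S. card (P \<times> {z} \<union> under r z \<times> P))"
    using assms by (intro card_UN_le) auto
  also have "\<dots> \<le> (\<Sum>z\<in>?S. card P * (max_indegree P r + 2))"
  proof (rule sum_mono)
    fix z assume "z \<in> ?S"
    have "card (P \<times> {z} \<union> under r z \<times> P) \<le> card P + card (under r z) * card P"
      using card_Un_le[of "P \<times> {z}" "under r z \<times> P"] by (simp add: card_cartesian_product)
    also have "\<dots> \<le> card P + Suc (max_indegree P r) * card P"
      using card_under_le[OF assms(1,2), of z] \<open>z \<in> ?S\<close> by (intro add_left_mono mult_right_mono) auto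
    finally show "card (P \<times> {z} \<union> under r z \<times> P) \<le> card P * (max_indegree P r + 2)"
      by (simp add: algebra_simps)
  qed
  also have "\<dots> = card ?S * (card P * (max_indegree P r + 2))"
    by simp
  also have "\<dots> \<le> (max_outdegree P r + 2) * (card P * (max_indegree P r + 2))"
  proof (rule mult_right_mono)
    have "card ?S \<le> card (insert b (above r a))"
      using fin by (intro card_mono) (auto simp: support_def)
    also have "\<dots> \<le> Suc (card (above r a))"
      using fin by (simp add: card_insert_if)
    finally show "card ?S \<le> max_outdegree P r + 2"
      using card_above_le[OF assms] by simp
  qed simp
  finally show ?thesis
    by (simp only: mult_ac)
qed

lemma dim2_le_if_prob_pos:
  assumes "partial_order_on P r"
    and pos: "0 < measure_pmf.prob M (\<Inter>c\<in>P \<times> P - r. - unseparated r {1..d} c)"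
  shows "dim2 P r \<le> d"
proof -
  have "(\<Inter>c\<in>P \<times> P - r. - unseparated r {1..d} c) \<noteq> {}"
    using pos by auto
  then obtain f where "\<And>c. c \<in> P \<times> P - r \<Longrightarrow> f \<notin> unseparated r {1..d} c"
    by auto
  then show ?thesis
    using assms(1) by (intro dim2_le_if_separated[where f = f]) (auto simp: unseparated_def)
qed

lemma dim2_le_union_bound:
  assumes "finite P" "partial_order_on P r" "P \<noteq> {}"
    and d: "2 * exp 1 * (real (max_outdegree P r) + 2) * ln (real (card P)) \<le> real d"
  shows "dim2 P r \<le> d"
proof -
  define u where "u = max_outdegree P r"
  define n where "n = card P"
  define M where "M = Pi_pmf (P \<times> {1..d}) False (\<lambda>_. bernoulli_pmf (1 / (real u + 2)))"
  let ?I = "P \<times> P - r"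
  have "0 < n"
    using assms by (simp add: n_def card_gt_0_iff)
  have "2 * ln (real n) * (exp 1 * (real u + 2)) \<le> real d"
    using d by (simp add: u_def n_def algebra_simps)
  then have "2 * ln (real n) \<le> real d / (exp 1 * (real u + 2))"
    by (subst pos_le_divide_eq) (auto intro: add_nonneg_pos)
  then have "exp (- (real d / (exp 1 * (real u + 2)))) \<le> exp (- (2 * ln (real n)))"
    by simp
  also have "\<dots> = 1 / real n ^ 2"
    using \<open>0 < n\<close> by (simp add: exp_minus exp_double inverse_eq_divide)
  finally have e: "exp (- (real d / (exp 1 * (real u + 2)))) \<le> 1 / real n ^ 2" .
  have "measure_pmf.prob M (unseparated r {1..d} c) \<le> 1 / real n ^ 2" if "c \<in> ?I" for c
  proof -
    obtain a b where c: "c = (a, b)"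
      by (cases c)
    show ?thesis
      unfolding M_def c
      by (rule order_trans[OF prob_unseparated_le e])
        (use that assms above_subset[OF assms(2), of a] card_above_le[OF assms(1,2), of a] 
          in \<open>auto simp: c u_def support_def\<close>)
  qed
  then have "(\<Sum>c\<in>?I. measure_pmf.prob M (unseparated r {1..d} c)) \<le> real (card ?I) * (1 / real n ^ 2)"
    by (rule sum_bounded_above)
  moreover have "measure_pmf.prob M (\<Union>c\<in>?I. unseparated r {1..d} c)
      \<le> (\<Sum>c\<in>?I. measure_pmf.prob M (unseparated r {1..d} c))"
    using assms by (intro measure_pmf.finite_measure_subadditive_finite) auto
  moreover have "real (card ?I) * (1 / real n ^ 2) < 1"
  proof -
    obtain x where "x \<in> P"
      using assms(3) by auto
    \<comment> \<open>Reflexive pairs need no separation; this makes the union bound strict.\<close>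
    then have "(x, x) \<in> P \<times> P \<inter> r"
      using partial_order_onD(3)[OF assms(2)] by auto
    then have "card ?I < card (P \<times> P)"
      using assms by (intro psubset_card_mono) auto
    then have "real (card ?I) < real (n ^ 2)"
      by (simp add: n_def card_cartesian_product power2_eq_square flip: of_nat_mult)
    then show ?thesis
      using \<open>0 < n\<close> by (simp add: divide_less_eq)
  qed
  ultimately have "measure_pmf.prob M (\<Union>c\<in>?I. unseparated r {1..d} c) < 1"
    by linarith
  moreover have "(\<Inter>c\<in>?I. - unseparated r {1..d} c) = UNIV - (\<Union>c\<in>?I. unseparated r {1..d} c)"
    by auto
  ultimately have "0 < measure_pmf.prob M (\<Inter>c\<in>?I. - unseparated r {1..d} c)"
    using measure_pmf.prob_compl[of "\<Union>c\<in>?I. unseparated r {1..d} c" M] by simp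
  then show ?thesis
    by (rule dim2_le_if_prob_pos[OF assms(2)])
qed

lemma dim2_le_local_lemma:
  assumes "finite P" "partial_order_on P r" "P \<noteq> {}"
    and d: "exp 1 * (real (max_outdegree P r) + 2) * (ln (real (card P))
        + ln (real (max_outdegree P r) + 2) + ln (real (max_indegree P r) + 2) + 1) \<le> real d"
  shows "dim2 P r \<le> d"
proof -
  define u where "u = max_outdegree P r"
  define N where "N = card P * (u + 2) * (max_indegree P r + 2)"
  define M where "M = Pi_pmf (P \<times> {1..d}) False (\<lambda>_. bernoulli_pmf (1 / (real u + 2)))"
  define q where "q = exp (- (real d / (exp 1 * (real u + 2))))"
  define \<Gamma> where "\<Gamma> c = {c' \<in> P \<times> P. support r c \<inter> support r c' \<noteq> {}}" for c
  let ?I = "P \<times> P - r"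
  have supp: "support r c \<subseteq> P" if "c \<in> P \<times> P" for c
    using that above_subset[OF assms(2)] by (auto simp: support_def)
  have n: "1 \<le> card P"
    using assms by (simp add: Suc_le_eq card_gt_0_iff)
  \<comment> \<open>The local lemma is applied with \<open>m = N - 1\<close>, which has to be positive.\<close>
  have "1 * 2 * 2 \<le> N"
    unfolding N_def using n by (intro mult_le_mono) auto
  then have N: "4 \<le> N"
    by simp
  have "real N = real (card P) * (real u + 2) * (real (max_indegree P r) + 2)"
    by (simp only: N_def of_nat_mult of_nat_add of_nat_numeral)
  then have "ln (real N) + 1 = ln (real (card P)) + ln (real u + 2) + ln (real (max_indegree P r) + 2) + 1"
    using n by (simp add: ln_mult)
  also have "\<dots> \<le> real d / (exp 1 * (real u + 2))"
    using d by (simp add: u_def pos_le_divide_eq mult_ac)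
  finally have "q \<le> exp (- (ln (real N) + 1))"
    by (simp add: q_def)
  also have "\<dots> = inverse (exp 1 * real N)"
    using N by (simp add: exp_minus exp_add del: minus_add_distrib)
  finally have q: "exp 1 * q * (real (N - 1) + 1) \<le> 1"
    using N by (simp add: of_nat_diff field_simps)
  have "0 < measure_pmf.prob M (\<Inter>c\<in>?I. - unseparated r {1..d} c)"
  proof (rule lovasz_local_lemma[where \<Gamma> = \<Gamma>, OF _ _ _ _ _ q])
    fix c assume c: "c \<in> ?I"
    obtain a b where ab: "c = (a, b)"
      by (cases c)
    show "finite (\<Gamma> c) \<and> c \<in> \<Gamma> c \<and> card (\<Gamma> c) \<le> Suc (N - 1)"
      using card_conflicting_pairs_le[OF assms(1,2), of a b] c assms(1) N
      by (auto simp: \<Gamma>_def N_def u_def ab support_def)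
    fix J assume J: "J \<subseteq> ?I - \<Gamma> c"
    have "measure_pmf.prob M (unseparated r {1..d} c \<inter> (\<Inter>j\<in>J. - unseparated r {1..d} j))
        = measure_pmf.prob M (unseparated r {1..d} c)
          * measure_pmf.prob M (\<Inter>j\<in>J. - unseparated r {1..d} j)"
      unfolding M_def
    proof (rule prob_Pi_pmf_Int_disjoint[OF _ _ _ _ depends_on_unseparated
          depends_on_Inter_Compl[OF depends_on_unseparated]])
      show "support r c \<times> {1..d} \<subseteq> P \<times> {1..d}"
        using supp[of c] c by auto
      show "(\<Union>j\<in>J. support r j \<times> {1..d}) \<subseteq> P \<times> {1..d}"
        using supp J by blast
      show "support r c \<times> {1..d} \<inter> (\<Union>j\<in>J. support r j \<times> {1..d}) = {}"
        using J unfolding \<Gamma>_def by blast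
    qed (use assms in auto)
    also have "measure_pmf.prob M (unseparated r {1..d} c) \<le> q"
      unfolding M_def ab q_def
      using c ab assms supp[of c] card_above_le[OF assms(1,2), of a]
      by (intro prob_unseparated_le) (auto simp: u_def)
    finally show "measure_pmf.prob M (unseparated r {1..d} c \<inter> (\<Inter>j\<in>J. - unseparated r {1..d} j))
        \<le> q * measure_pmf.prob M (\<Inter>j\<in>J. - unseparated r {1..d} j)"
      by (simp add: mult_right_mono)
  qed (use assms N in \<open>auto simp: q_def\<close>)
  then show ?thesis
    by (rule dim2_le_if_prob_pos[OF assms(2)])
qed

lemma int_le_ceilingI:
  assumes "0 \<le> x" and "\<And>d. x \<le> real d \<Longrightarrow> k \<le> d"
  shows "int k \<le> \<lceil>x\<rceil>"
proof -
  have "k \<le> nat \<lceil>x\<rceil>"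
    by (rule assms(2)) (rule real_nat_ceiling_ge)
  then have "int k \<le> int (nat \<lceil>x\<rceil>)"
    by (simp only: of_nat_le_iff)
  also have "\<dots> = \<lceil>x\<rceil>"
    using assms(1) by simp
  finally show ?thesis .
qed

theorem lemma6p1:
  fixes P :: "'a set" and r :: "'a rel" and n \<upsilon> \<delta> :: nat
  assumes "finite P" and "partial_order_on P r"
    and "n = card P"
    and "\<upsilon> = max_outdegree P r"
    and "\<delta> = max_indegree P r"
  shows "int (dim2 P r) \<le> \<lceil>2 * exp 1 * (real \<upsilon> + 2) * ln (real n)\<rceil>
    \<and> int (dim2 P r) \<le>
        \<lceil>exp 1 * (real \<upsilon> + 2) * (ln (real n) + ln (real \<upsilon> + 2) + ln (real \<delta> + 2) + 1)\<rceil>"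
proof -
  define X where "X = 2 * exp 1 * (real \<upsilon> + 2) * ln (real n)"
  define Y where "Y = exp 1 * (real \<upsilon> + 2) * (ln (real n) + ln (real \<upsilon> + 2) + ln (real \<delta> + 2) + 1)"
  have "0 \<le> ln (real n)"
    by (cases "n = 0") auto
  then have XY: "0 \<le> X" "0 \<le> Y"
    by (auto simp: X_def Y_def)
  have "int (dim2 P r) \<le> \<lceil>X\<rceil> \<and> int (dim2 P r) \<le> \<lceil>Y\<rceil>"
  proof (cases "P = {}")
    case True
    \<comment> \<open>Here \<open>\<upsilon>\<close> and \<open>\<delta>\<close> are arbitrary numbers and \<open>ln 0 = 0\<close>; the two right-hand sides
      are nonnegative all the same.\<close>
    then have "dim2 P r \<le> 0"
      using dim2_le_if_separated[OF assms(2), of 0] by simp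
    then show ?thesis
      using XY by simp
  next
    case False
    then show ?thesis
      using XY dim2_le_union_bound[OF assms(1,2)] dim2_le_local_lemma[OF assms(1,2)]
      unfolding X_def Y_def assms(3-5) by (auto intro!: int_le_ceilingI)
  qed
  then show ?thesis
    by (simp add: X_def Y_def)
qed

end
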